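(* Let $L$ be a completely distributive lattice, $G$ a group, and $\mu$ an $L$-subgroup of $G$. Let $\eta$ be a maximal $L$-subgroup of $\mu$. Then $\eta$ is either a normal $L$-subgroup of $\mu$ or an abnormal $L$-subgroup of $\mu$.
   Context: $L$ is a completely distributive (in particular complete) lattice with greatest element $1$ and least element $0$; $G$ is a group. An $L$-subset of $G$ is a function $G\to L$; $\eta\subseteq\nu$ means $\eta(x)\le\nu(x)$ for all $x\in G$; $(\eta\cup\nu)(x)=\eta(x)\vee\nu(x)$. An $L$-subgroup of $G$ is an $L$-subset $\mu$ with $\mu(xy)\ge\mu(x)\wedge\mu(y)$ and $\mu(x^{-1})=\mu(x)$ for all $x,y\in G$. An $L$-subgroup of $\mu$ is an $L$-subgroup $\eta$ of $G$ with $\eta\subseteq\mu$. It is proper if $\eta$ is non-constant and $\eta\ne\mu$. It is a normal $L$-subgroup of $\mu$ if $\eta(yxy^{-1})\ge\eta(x)\wedge\mu(y)$ for all $x,y\in G$. A proper $L$-subgroup $\eta$ of $\mu$ is a maximal $L$-subgroup of $\mu$ if whenever $\eta\subseteq\theta\subseteq\mu$ for some $L$-subgroup $\theta$ of $\mu$, then $\theta=\eta$ or $\theta=\mu$. For $a\in L$, $x\in G$, the $L$-point $a_x$ is the $L$-subset with value $a$ at $x$ and $0$ elsewhere; $a_x\in\mu$ means $\mu(x)\ge a$. For $\eta$ an $L$-subgroup of $\mu$ and $a_z\in\mu$, the conjugate $\eta^{a_z}$ is the $L$-subset $\eta^{a_z}(x)=a\wedge\eta(zxz^{-1})$, $x\in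 G$ (it is an $L$-subgroup of $\mu$). For $L$-subsets $\eta,\nu\subseteq\mu$, $\langle\eta,\nu\rangle$ is the $L$-subgroup of $\mu$ generated by $\eta\cup\nu$, i.e. the pointwise infimum of all $L$-subgroups $\theta$ of $\mu$ with $\eta\cup\nu\subseteq\theta$. An $L$-subgroup $\eta$ of $\mu$ is an abnormal $L$-subgroup of $\mu$ if for every $L$-point $a_x\in\mu$ one has $a_x\in\langle\eta,\eta^{a_x}\rangle$. *)

theory Defs
  imports "HOL-Algebra.Group"
begin

(* The lattice L is the type 'l of class complete_distrib_lattice, whose axiom is complete
   distributivity in the strong sense (arbitrary meets of arbitrary joins).
   L-subsets of G are functions carrier G \<rightarrow> L represented extensionally, i.e. with value
   undefined outside carrier G, so that HOL equality is equality of L-subsets. *)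

definition L_subset :: "('a, 'b) monoid_scheme \<Rightarrow> ('a \<Rightarrow> 'l) \<Rightarrow> bool" where
  "L_subset G \<eta> \<longleftrightarrow> \<eta> \<in> carrier G \<rightarrow>\<^sub>E UNIV"

definition L_subseteq ::
    "('a, 'b) monoid_scheme \<Rightarrow> ('a \<Rightarrow> 'l::complete_distrib_lattice) \<Rightarrow> ('a \<Rightarrow> 'l) \<Rightarrow> bool" where
  "L_subseteq G \<eta> \<nu> \<longleftrightarrow> (\<forall>x\<in>carrier G. \<eta> x \<le> \<nu> x)"

definition L_union ::
    "('a, 'b) monoid_scheme \<Rightarrow> ('a \<Rightarrow> 'l::complete_distrib_lattice) \<Rightarrow> ('a \<Rightarrow> 'l) \<Rightarrow> ('a \<Rightarrow> 'l)" where
  "L_union G \<eta> \<nu> = (\<lambda>x\<in>carrier G. sup (\<eta> x) (\<nu> x))"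

definition L_subgroup ::
    "('a, 'b) monoid_scheme \<Rightarrow> ('a \<Rightarrow> 'l::complete_distrib_lattice) \<Rightarrow> bool" where
  "L_subgroup G \<mu> \<longleftrightarrow> L_subset G \<mu> \<and>
     (\<forall>x\<in>carrier G. \<forall>y\<in>carrier G. \<mu> (x \<otimes>\<^bsub>G\<^esub> y) \<ge> inf (\<mu> x) (\<mu> y)) \<and>
     (\<forall>x\<in>carrier G. \<mu> (inv\<^bsub>G\<^esub> x) = \<mu> x)"

definition L_subgroup_of ::
    "('a, 'b) monoid_scheme \<Rightarrow> ('a \<Rightarrow> 'l::complete_distrib_lattice) \<Rightarrow> ('a \<Rightarrow> 'l) \<Rightarrow> bool" where
  "L_subgroup_of G \<mu> \<eta> \<longleftrightarrow> L_subgroup G \<eta> \<and> L_subseteq G \<eta> \<mu>"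

definition proper_L_subgroup_of ::
    "('a, 'b) monoid_scheme \<Rightarrow> ('a \<Rightarrow> 'l::complete_distrib_lattice) \<Rightarrow> ('a \<Rightarrow> 'l) \<Rightarrow> bool" where
  "proper_L_subgroup_of G \<mu> \<eta> \<longleftrightarrow> L_subgroup_of G \<mu> \<eta> \<and>
     \<not> (\<exists>c. \<forall>x\<in>carrier G. \<eta> x = c) \<and> \<eta> \<noteq> \<mu>"

definition normal_L_subgroup_of ::
    "('a, 'b) monoid_scheme \<Rightarrow> ('a \<Rightarrow> 'l::complete_distrib_lattice) \<Rightarrow> ('a \<Rightarrow> 'l) \<Rightarrow> bool" where
  "normal_L_subgroup_of G \<mu> \<eta> \<longleftrightarrow> L_subgroup_of G \<mu> \<eta> \<and>
     (\<forall>x\<in>carrier G. \<forall>y\<in>carrier G.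
        \<eta> (y \<otimes>\<^bsub>G\<^esub> x \<otimes>\<^bsub>G\<^esub> inv\<^bsub>G\<^esub> y) \<ge> inf (\<eta> x) (\<mu> y))"

definition maximal_L_subgroup_of ::
    "('a, 'b) monoid_scheme \<Rightarrow> ('a \<Rightarrow> 'l::complete_distrib_lattice) \<Rightarrow> ('a \<Rightarrow> 'l) \<Rightarrow> bool" where
  "maximal_L_subgroup_of G \<mu> \<eta> \<longleftrightarrow> proper_L_subgroup_of G \<mu> \<eta> \<and>
     (\<forall>\<theta>. L_subgroup_of G \<mu> \<theta> \<and> L_subseteq G \<eta> \<theta> \<longrightarrow> \<theta> = \<eta> \<or> \<theta> = \<mu>)"

(* Membership of the L-point with value a at x. Both this relation and the conjugate below
   depend on the pair (a, x), so an L-point is passed as such a pair. *)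
definition L_point_in :: "'l::complete_distrib_lattice \<Rightarrow> 'a \<Rightarrow> ('a \<Rightarrow> 'l) \<Rightarrow> bool" where
  "L_point_in a x \<mu> \<longleftrightarrow> a \<le> \<mu> x"

definition L_conjugate ::
    "('a, 'b) monoid_scheme \<Rightarrow> ('a \<Rightarrow> 'l::complete_distrib_lattice) \<Rightarrow> 'l \<Rightarrow> 'a \<Rightarrow> ('a \<Rightarrow> 'l)" where
  "L_conjugate G \<eta> a z =
     (\<lambda>x\<in>carrier G. inf a (\<eta> (z \<otimes>\<^bsub>G\<^esub> x \<otimes>\<^bsub>G\<^esub> inv\<^bsub>G\<^esub> z)))"

(* Meaningful for \<eta>, \<nu> contained in \<mu>: then \<mu> itself occurs in the infimum. *)
definition L_generated ::
    "('a, 'b) monoid_scheme \<Rightarrow> ('a \<Rightarrow> 'l::complete_distrib_lattice) \<Rightarrow> ('a \<Rightarrow> 'l) \<Rightarrow> ('a \<Rightarrow> 'l)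
      \<Rightarrow> ('a \<Rightarrow> 'l)" where
  "L_generated G \<mu> \<eta> \<nu> =
     (\<lambda>x\<in>carrier G. INF \<theta>\<in>{\<theta>. L_subgroup_of G \<mu> \<theta> \<and> L_subseteq G (L_union G \<eta> \<nu>) \<theta>}. \<theta> x)"

definition abnormal_L_subgroup_of ::
    "('a, 'b) monoid_scheme \<Rightarrow> ('a \<Rightarrow> 'l::complete_distrib_lattice) \<Rightarrow> ('a \<Rightarrow> 'l) \<Rightarrow> bool" where
  "abnormal_L_subgroup_of G \<mu> \<eta> \<longleftrightarrow> L_subgroup_of G \<mu> \<eta> \<and>
     (\<forall>a. \<forall>x\<in>carrier G. L_point_in a x \<mu> \<longrightarrow>
        L_point_in a x (L_generated G \<mu> \<eta> (L_conjugate G \<eta> a x)))"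

end

theory Submission
  imports Defs
begin

text \<open>
  If \<open>\<eta>\<close> is not abnormal, maximality yields \<open>a\<close> and \<open>z\<close> with \<open>a \<le> \<mu> z\<close>, \<open>\<not> a \<le> \<eta> z\<close> and
  the conjugate of \<open>\<eta>\<close> by the point \<open>a\<^sub>z\<close> contained in \<open>\<eta>\<close>. Under this inclusion the union of
  \<open>\<eta>\<close> with its conjugate by \<open>a\<close> at the inverse of \<open>z\<close> is already an \<open>L\<close>-subgroup of \<open>\<mu>\<close>; its
  value at \<open>z\<close> is \<open>\<eta> z\<close>, which does not lie above \<open>a\<close>, so by maximality it equals \<open>\<eta>\<close>. Hence \<open>a\<close>
  at \<open>z\<close> normalizes \<open>\<eta>\<close> in both directions, the normalizer of \<open>\<eta>\<close> in \<open>\<mu>\<close>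
  is strictly larger than \<open>\<eta>\<close>, and maximality makes it equal to \<open>\<mu>\<close>.
\<close>

text \<open>Both directions of conjugation are demanded so that the condition is symmetric under
  inverting \<open>y\<close>. This is what makes the normalizer below closed under inverses.\<close>

definition L_normalizes ::
    "('a, 'b) monoid_scheme \<Rightarrow> ('a \<Rightarrow> 'l::complete_distrib_lattice) \<Rightarrow> 'l \<Rightarrow> 'a \<Rightarrow> bool" where
  "L_normalizes G \<eta> b y \<longleftrightarrow> (\<forall>x\<in>carrier G.
     inf b (\<eta> x) \<le> \<eta> (y \<otimes>\<^bsub>G\<^esub> x \<otimes>\<^bsub>G\<^esub> inv\<^bsub>G\<^esub> y) \<and>
     inf b (\<eta> x) \<le> \<eta> (inv\<^bsub>G\<^esub> y \<otimes>\<^bsub>G\<^esub> x \<otimes>\<^bsub>G\<^esub> y))"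

definition L_normalizer ::
    "('a, 'b) monoid_scheme \<Rightarrow> ('a \<Rightarrow> 'l::complete_distrib_lattice) \<Rightarrow> ('a \<Rightarrow> 'l) \<Rightarrow> ('a \<Rightarrow> 'l)" where
  "L_normalizer G \<mu> \<eta> = (\<lambda>y\<in>carrier G. inf (\<mu> y) (Sup {b. L_normalizes G \<eta> b y}))"

text \<open>With a free lower bound \<open>c\<close>, this is closure of a level set under products;
  later estimates take for \<open>c\<close> whichever meet is at hand.\<close>

lemma L_subgroup_mult:
  assumes "L_subgroup G \<eta>" "x \<in> carrier G" "y \<in> carrier G" "c \<le> \<eta> x" "c \<le> \<eta> y"
  shows "c \<le> \<eta> (x \<otimes>\<^bsub>G\<^esub> y)"
  using assms unfolding L_subgroup_def by (meson le_inf_iff order_trans)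

lemma L_subgroup_inv:
  assumes "L_subgroup G \<eta>" "x \<in> carrier G"
  shows "\<eta> (inv\<^bsub>G\<^esub> x) = \<eta> x"
  using assms unfolding L_subgroup_def by blast

context group
begin

lemma L_subgroup_conj:
  assumes "L_subgroup G \<eta>" "x \<in> carrier G" "y \<in> carrier G" "c \<le> \<eta> x" "c \<le> \<eta> y"
  shows "c \<le> \<eta> (y \<otimes> x \<otimes> inv y)"
  using assms by (simp add: L_subgroup_mult L_subgroup_inv)

lemma inv_mult_cancel_left:
  assumes "x \<in> carrier G" "z \<in> carrier G"
  shows "inv z \<otimes> (z \<otimes> x) = x" "z \<otimes> (inv z \<otimes> x) = x"
  using assms by (simp_all flip: m_assoc)

lemma conj_mult:
  assumes "x \<in> carrier G" "y \<in> carrier G" "z \<in> carrier G"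
  shows "z \<otimes> (x \<otimes> y) \<otimes> inv z = (z \<otimes> x \<otimes> inv z) \<otimes> (z \<otimes> y \<otimes> inv z)"
  using assms by (simp add: m_assoc inv_mult_cancel_left)

lemma conj_inv:
  assumes "x \<in> carrier G" "z \<in> carrier G"
  shows "z \<otimes> inv x \<otimes> inv z = inv (z \<otimes> x \<otimes> inv z)"
  using assms by (simp add: inv_mult_group m_assoc)

lemma L_normalizes_inv:
  "L_normalizes G \<eta> b y \<Longrightarrow> y \<in> carrier G \<Longrightarrow> L_normalizes G \<eta> b (inv y)"
  unfolding L_normalizes_def by simp

lemma L_normalizes_mult:
  assumes "L_normalizes G \<eta> b y" "L_normalizes G \<eta> c z" "y \<in> carrier G" "z \<in> carrier G"
  shows "L_normalizes G \<eta> (inf b c) (y \<otimes> z)"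
  unfolding L_normalizes_def
proof (intro ballI conjI)
  fix x assume x: "x \<in> carrier G"
  have "inf b (inf c (\<eta> x)) \<le> inf b (\<eta> (z \<otimes> x \<otimes> inv z))"
    using assms x unfolding L_normalizes_def by (intro inf_mono) auto
  also have "\<dots> \<le> \<eta> (y \<otimes> (z \<otimes> x \<otimes> inv z) \<otimes> inv y)"
    using assms x unfolding L_normalizes_def by simp
  finally show "inf (inf b c) (\<eta> x) \<le> \<eta> (y \<otimes> z \<otimes> x \<otimes> inv (y \<otimes> z))"
    using assms x by (simp add: inf_assoc inv_mult_group m_assoc)
  \<comment> \<open>Conjugating by the inverse of \<open>y \<otimes> z\<close> applies
    \<open>y\<close> first, so \<open>b\<close> has to be used before \<open>c\<close>.\<close>
  have "inf (inf b c) (\<eta> x) = inf c (inf b (\<eta> x))"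
    by (simp only: inf_aci)
  also have "\<dots> \<le> inf c (\<eta> (inv y \<otimes> x \<otimes> y))"
    using assms x unfolding L_normalizes_def by (intro inf_mono) auto
  also have "\<dots> \<le> \<eta> (inv z \<otimes> (inv y \<otimes> x \<otimes> y) \<otimes> z)"
    using assms x unfolding L_normalizes_def by simp
  finally show "inf (inf b c) (\<eta> x) \<le> \<eta> (inv (y \<otimes> z) \<otimes> x \<otimes> (y \<otimes> z))"
    using assms x by (simp add: inv_mult_group m_assoc)
qed

lemma L_normalizes_self:
  assumes "L_subgroup G \<eta>" "y \<in> carrier G"
  shows "L_normalizes G \<eta> (\<eta> y) y"
  unfolding L_normalizes_def
proof (intro ballI conjI)
  fix x assume x: "x \<in> carrier G"
  show "inf (\<eta> y) (\<eta> x) \<le> \<eta> (y \<otimes> x \<otimes> inv y)"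
    using assms x by (simp add: L_subgroup_conj)
  show "inf (\<eta> y) (\<eta> x) \<le> \<eta> (inv y \<otimes> x \<otimes> y)"
    using L_subgroup_conj[OF assms(1) x, of "inv y" "inf (\<eta> y) (\<eta> x)"] assms
    by (simp add: L_subgroup_inv)
qed

lemma L_normalizes_mono:
  "L_normalizes G \<eta> b y \<Longrightarrow> c \<le> b \<Longrightarrow> L_normalizes G \<eta> c y"
  unfolding L_normalizes_def by (meson inf_mono order_refl order_trans)

text \<open>Binary meet distributes over arbitrary joins, so the supremum in
  \<open>L_normalizer\<close> is attained.\<close>

lemma L_normalizes_Sup:
  "L_normalizes G \<eta> (Sup {b. L_normalizes G \<eta> b y}) y"
  unfolding L_normalizes_def Sup_inf by (auto intro!: SUP_least)

text \<open>Because the supremum is attained, the normalizer is determined by the points it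
  contains, and its subgroup laws reduce to the closure properties of
  \<open>L_normalizes\<close>.\<close>

lemma le_L_normalizer_iff:
  assumes "y \<in> carrier G"
  shows "b \<le> L_normalizer G \<mu> \<eta> y \<longleftrightarrow> b \<le> \<mu> y \<and> L_normalizes G \<eta> b y"
  using assms L_normalizes_mono[OF L_normalizes_Sup]
  by (auto simp: L_normalizer_def intro: Sup_upper)

lemma L_normalizer_L_subgroup_of:
  assumes \<mu>: "L_subgroup G \<mu>"
  shows "L_subgroup_of G \<mu> (L_normalizer G \<mu> \<eta>)"
proof -
  let ?N = "L_normalizer G \<mu> \<eta>"
  have N: "?N y \<le> \<mu> y" "L_normalizes G \<eta> (?N y) y" if "y \<in> carrier G" for y
    using le_L_normalizer_iff[OF that, of "?N y" \<mu> \<eta>] by auto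
  have mult: "inf (?N x) (?N y) \<le> ?N (x \<otimes> y)" if "x \<in> carrier G" "y \<in> carrier G" for x y
    using that N
    by (simp add: le_L_normalizer_iff L_normalizes_mult L_subgroup_mult[OF \<mu>]
        le_infI1 le_infI2)
  have inv_le: "?N x \<le> ?N (inv x)" if "x \<in> carrier G" for x
    using that N by (simp add: le_L_normalizer_iff L_normalizes_inv L_subgroup_inv[OF \<mu>])
  have "?N (inv x) = ?N x" if "x \<in> carrier G" for x
    using inv_le[OF that] inv_le[of "inv x"] that by (simp add: order_antisym)
  then show ?thesis
    using mult N unfolding L_subgroup_of_def L_subgroup_def L_subset_def L_subseteq_def
    by (auto simp: L_normalizer_def)
qed

lemma L_subseteq_L_normalizer:
  assumes "L_subgroup_of G \<mu> \<eta>"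
  shows "L_subseteq G \<eta> (L_normalizer G \<mu> \<eta>)"
  using assms unfolding L_subgroup_of_def L_subseteq_def
  by (simp add: le_L_normalizer_iff L_normalizes_self)

text \<open>Conjugation by \<open>z\<close> permutes the group, so one may substitute along it.
  Inclusion of the conjugate thus amounts to one of the two halves of
  \<open>L_normalizes\<close>.\<close>

lemma L_conjugate_subset_iff:
  assumes "z \<in> carrier G"
  shows "L_subseteq G (L_conjugate G \<eta> a z) \<eta> \<longleftrightarrow>
    (\<forall>x\<in>carrier G. inf a (\<eta> x) \<le> \<eta> (inv z \<otimes> x \<otimes> z))"
proof
  assume sub: "L_subseteq G (L_conjugate G \<eta> a z) \<eta>"
  show "\<forall>x\<in>carrier G. inf a (\<eta> x) \<le> \<eta> (inv z \<otimes> x \<otimes> z)"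
  proof
    fix x assume x: "x \<in> carrier G"
    have "z \<otimes> (inv z \<otimes> x \<otimes> z) \<otimes> inv z = x"
      using assms x by (simp add: m_assoc inv_mult_cancel_left)
    then show "inf a (\<eta> x) \<le> \<eta> (inv z \<otimes> x \<otimes> z)"
      using sub assms x unfolding L_subseteq_def L_conjugate_def
      by (auto dest!: bspec[where x = "inv z \<otimes> x \<otimes> z"])
  qed
next
  assume le: "\<forall>x\<in>carrier G. inf a (\<eta> x) \<le> \<eta> (inv z \<otimes> x \<otimes> z)"
  show "L_subseteq G (L_conjugate G \<eta> a z) \<eta>"
    unfolding L_subseteq_def
  proof
    fix x assume x: "x \<in> carrier G"
    have "inv z \<otimes> (z \<otimes> x \<otimes> inv z) \<otimes> z = x"
      using assms x by (simp add: m_assoc inv_mult_cancel_left)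
    then show "L_conjugate G \<eta> a z x \<le> \<eta> x"
      using le assms x unfolding L_conjugate_def
      by (auto dest!: bspec[where x = "z \<otimes> x \<otimes> inv z"])
  qed
qed

text \<open>Distributing a meet of two joins gives four terms. The pure ones are handled by
  multiplicativity of \<eta>; in a mixed one, \<open>le\<close> moves the factor from \<eta> into
  the conjugate, where both factors can then be multiplied.\<close>

lemma L_union_L_conjugate_L_subgroup_of:
  assumes \<eta>: "L_subgroup_of G \<mu> \<eta>" and \<mu>: "L_subgroup G \<mu>"
    and w: "w \<in> carrier G" "a \<le> \<mu> w"
    and le: "\<And>x. x \<in> carrier G \<Longrightarrow> inf a (\<eta> x) \<le> \<eta> (w \<otimes> x \<otimes> inv w)"
  shows "L_subgroup_of G \<mu> (L_union G \<eta> (L_conjugate G \<eta> a w))"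
proof -
  have sub: "L_subgroup G \<eta>" and \<eta>\<mu>: "\<And>x. x \<in> carrier G \<Longrightarrow> \<eta> x \<le> \<mu> x"
    using \<eta> unfolding L_subgroup_of_def L_subseteq_def by auto
  let ?c = "\<lambda>x. w \<otimes> x \<otimes> inv w"
  have \<kappa>: "L_union G \<eta> (L_conjugate G \<eta> a w) x = sup (\<eta> x) (inf a (\<eta> (?c x)))"
    if "x \<in> carrier G" for x
    using that by (simp add: L_union_def L_conjugate_def)
  have mult: "inf (sup (\<eta> x) (inf a (\<eta> (?c x)))) (sup (\<eta> y) (inf a (\<eta> (?c y))))
      \<le> sup (\<eta> (x \<otimes> y)) (inf a (\<eta> (?c (x \<otimes> y))))"
    if x: "x \<in> carrier G" and y: "y \<in> carrier G" for x y
  proof -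
    have c: "c \<le> sup (\<eta> (x \<otimes> y)) (inf a (\<eta> (?c (x \<otimes> y))))"
      if "c \<le> a" "c \<le> \<eta> (?c x)" "c \<le> \<eta> (?c y)" for c
      using that w x y L_subgroup_mult[OF sub, of "?c x" "?c y" c]
      by (simp add: conj_mult le_supI2)
    have "inf (\<eta> x) (\<eta> y) \<le> sup (\<eta> (x \<otimes> y)) (inf a (\<eta> (?c (x \<otimes> y))))"
      using x y by (intro le_supI1 L_subgroup_mult[OF sub]) auto
    moreover have "inf (\<eta> x) (inf a (\<eta> (?c y))) \<le> sup (\<eta> (x \<otimes> y)) (inf a (\<eta> (?c (x \<otimes> y))))"
      by (rule c[OF _ order_trans[OF _ le[OF x]]]) (simp_all add: le_infI1 le_infI2)
    moreover have "inf (inf a (\<eta> (?c x))) (\<eta> y) \<le> sup (\<eta> (x \<otimes> y)) (inf a (\<eta> (?c (x \<otimes> y))))"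
      by (rule c[OF _ _ order_trans[OF _ le[OF y]]]) (simp_all add: le_infI1 le_infI2)
    moreover have "inf (inf a (\<eta> (?c x))) (inf a (\<eta> (?c y)))
        \<le> sup (\<eta> (x \<otimes> y)) (inf a (\<eta> (?c (x \<otimes> y))))"
      by (rule c) (auto intro: le_infI1 le_infI2)
    ultimately show ?thesis
      by (simp add: inf_sup_distrib1 inf_sup_distrib2)
  qed
  have inv: "sup (\<eta> (inv x)) (inf a (\<eta> (?c (inv x)))) = sup (\<eta> x) (inf a (\<eta> (?c x)))"
    if "x \<in> carrier G" for x
    using that w by (simp add: conj_inv L_subgroup_inv[OF sub])
  have below: "inf a (\<eta> (?c x)) \<le> \<mu> x" if x: "x \<in> carrier G" for x
  proof -
    \<comment> \<open>Here \<open>x\<close> is recovered from \<open>?c x\<close> by conjugating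
      back; this stays inside \<mu> because \<open>a\<close> is below the value of \<mu> at
      \<open>w\<close>.\<close>
    have "inf a (\<eta> (?c x)) \<le> \<mu> (inv w \<otimes> ?c x \<otimes> inv (inv w))"
    proof (rule L_subgroup_conj[OF \<mu>])
      show "inf a (\<eta> (?c x)) \<le> \<mu> (?c x)"
        using x w by (intro le_infI2 \<eta>\<mu>) auto
      show "inf a (\<eta> (?c x)) \<le> \<mu> (inv w)"
        using w by (simp add: L_subgroup_inv[OF \<mu>] le_infI1)
    qed (use x w in auto)
    also have "inv w \<otimes> ?c x \<otimes> inv (inv w) = x"
      using x w by (simp add: m_assoc inv_mult_cancel_left)
    finally show ?thesis .
  qed
  show ?thesis
    unfolding L_subgroup_of_def L_subgroup_def L_subset_def L_subseteq_def
    using mult inv \<eta>\<mu> below by (simp add: \<kappa>) (simp add: L_union_def)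
qed

end

theorem theorem3p21:
  fixes G :: "('a, 'b) monoid_scheme"
    and \<mu> \<eta> :: "'a \<Rightarrow> 'l::complete_distrib_lattice"
  assumes "group G"
    and "L_subgroup G \<mu>"
    and "maximal_L_subgroup_of G \<mu> \<eta>"
  shows "normal_L_subgroup_of G \<mu> \<eta> \<or> abnormal_L_subgroup_of G \<mu> \<eta>"
proof (rule disjCI)
  interpret group G by fact
  have \<eta>: "L_subgroup_of G \<mu> \<eta>"
    and max: "\<And>\<theta>. L_subgroup_of G \<mu> \<theta> \<Longrightarrow> L_subseteq G \<eta> \<theta> \<Longrightarrow> \<theta> = \<eta> \<or> \<theta> = \<mu>"
    using assms(3) unfolding maximal_L_subgroup_of_def proper_L_subgroup_of_def by auto
  assume "\<not> abnormal_L_subgroup_of G \<mu> \<eta>"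
  then obtain a z where z: "z \<in> carrier G" "a \<le> \<mu> z"
    and "\<not> a \<le> L_generated G \<mu> \<eta> (L_conjugate G \<eta> a z) z"
    using \<eta> unfolding abnormal_L_subgroup_of_def L_point_in_def by auto
  \<comment> \<open>A value not below an infimum is not below some member, so a single \<theta> can
    stand in for the generated subgroup. It differs from \<mu> at \<open>z\<close>.\<close>
  then obtain \<theta> where \<theta>: "L_subgroup_of G \<mu> \<theta>"
    "L_subseteq G (L_union G \<eta> (L_conjugate G \<eta> a z)) \<theta>" "\<not> a \<le> \<theta> z"
    unfolding L_generated_def by (auto simp: le_INF_iff)
  then have "\<theta> = \<eta>"
    using max[of \<theta>] z by (auto simp: L_subseteq_def L_union_def)
  with \<theta> have az: "\<not> a \<le> \<eta> z" and "L_subseteq G (L_conjugate G \<eta> a z) \<eta>"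
    by (auto simp: L_subseteq_def L_union_def)
  then have le: "inf a (\<eta> x) \<le> \<eta> (inv\<^bsub>G\<^esub> z \<otimes>\<^bsub>G\<^esub> x \<otimes>\<^bsub>G\<^esub> z)" if "x \<in> carrier G" for x
    using that z by (simp add: L_conjugate_subset_iff)
  \<comment> \<open>So far \<open>le\<close> gives only one half of \<open>L_normalizes\<close>. It
    is also the hypothesis under which joining the conjugate by the inverse yields an
    L-subgroup.\<close>
  define \<kappa> where "\<kappa> = L_union G \<eta> (L_conjugate G \<eta> a (inv\<^bsub>G\<^esub> z))"
  have "L_subgroup_of G \<mu> \<kappa>"
    unfolding \<kappa>_def
    using \<eta> assms(2) z le by (intro L_union_L_conjugate_L_subgroup_of) (auto simp: L_subgroup_inv)
  moreover have "L_subseteq G \<eta> \<kappa>"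
    by (simp add: \<kappa>_def L_subseteq_def L_union_def)
  \<comment> \<open>Conjugation by the inverse of \<open>z\<close> fixes \<open>z\<close>, so the
    added term is \<open>inf a (\<eta> z)\<close> and is absorbed.\<close>
  moreover have "\<kappa> z = \<eta> z"
    using z by (simp add: \<kappa>_def L_union_def L_conjugate_def sup_absorb1)
  ultimately have "\<kappa> = \<eta>"
    using max[of \<kappa>] az z by auto
  moreover have "L_subseteq G (L_conjugate G \<eta> a (inv\<^bsub>G\<^esub> z)) \<kappa>"
    by (simp add: \<kappa>_def L_subseteq_def L_union_def)
  \<comment> \<open>The conjugate by the inverse of \<open>z\<close> now lies in \<eta>, which
    supplies the missing half.\<close>
  ultimately have "L_normalizes G \<eta> a z"
    using z le L_conjugate_subset_iff[of "inv\<^bsub>G\<^esub> z" \<eta> a] by (simp add: L_normalizes_def)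
  then have "a \<le> L_normalizer G \<mu> \<eta> z"
    using z by (simp add: le_L_normalizer_iff)
  \<comment> \<open>The normalizer cannot be \<eta>: at \<open>z\<close> it lies above
    \<open>a\<close>, and \<eta> does not.\<close>
  then have N: "L_normalizer G \<mu> \<eta> = \<mu>"
    using max[OF L_normalizer_L_subgroup_of[OF assms(2)] L_subseteq_L_normalizer[OF \<eta>]] az by auto
  have "L_normalizes G \<eta> (\<mu> y) y" if "y \<in> carrier G" for y
    using le_L_normalizer_iff[OF that, of "\<mu> y" \<mu> \<eta>] N by simp
  then show "normal_L_subgroup_of G \<mu> \<eta>"
    using \<eta> unfolding normal_L_subgroup_of_def L_normalizes_def by (auto simp: inf.commute)
qed

end
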